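(* For every integer $k\ge 4$ we have $$T_o(2k+1)\ge (\sqrt 2)^{(k+1)(k-4)}.$$
   Context: For a positive integer $k$, $T_o(k)$ denotes the number of solutions of $\sum_{i=1}^k\frac 1{x_i}=1$ in odd integers $x_1,\dots,x_k$ with $1<x_1<x_2<\cdots <x_k$. *)

theory Defs
  imports Complex_Main
begin

text \<open>
  A solution \<open>(x\<^sub>1, \<dots>, x\<^sub>k)\<close> is the list of its entries.
\<close>

definition odd_unit_fraction_solutions :: "nat \<Rightarrow> int list set" where
  "odd_unit_fraction_solutions k =
     {xs. length xs = k \<and> sorted_wrt (<) xs \<and> (\<forall>x\<in>set xs. odd x \<and> 1 < x) \<and>
          (\<Sum>x\<leftarrow>xs. 1 / real_of_int x) = 1}"

text \<open>
  There are only finitely many solutions of each length, so \<^const>\<open>card\<close> is a genuine count here;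
  were the set infinite, \<^const>\<open>card\<close> would be 0, so a positive lower bound on \<open>T\<^sub>o\<close> is
  never obtained from that convention.
\<close>

definition T_o :: "nat \<Rightarrow> nat" where
  "T_o k = card (odd_unit_fraction_solutions k)"

end

theory Submission
  imports Defs "HOL-Computational_Algebra.Primes"
begin

text \<open>
  If \<open>a, b\<close> divide the largest denominator \<open>x\<close> and \<open>s = 1 + a + b\<close>, then
  \<open>1 / x = 1 / (x s / a) + 1 / (x s / b) + 1 / (x s)\<close>, which lengthens a solution by two entries.
  Keep \<open>x = 27 y\<close> with \<open>3\<close> not dividing \<open>y\<close>. For a divisor \<open>e\<close> of \<open>y\<close> put \<open>a = 3 e\<close> and
  \<open>b = 27 d\<close>, where \<open>d\<close> is the largest divisor of \<open>y\<close> coprime to \<open>1 + a\<close>. Then \<open>s\<close> is coprime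
  to \<open>x\<close>, so \<open>y s\<close> has at least twice as many divisors as \<open>y\<close>. Starting from
  \<open>3, 5, 7, 9, 11, 15, 21, 135, 27 * 385\<close>, where \<open>385\<close> has \<open>2 ^ 3\<close> divisors, the step from
  \<open>2 k + 1\<close> to \<open>2 k + 3\<close> entries therefore multiplies the number of solutions by at least
  \<open>2 ^ (k - 1)\<close>.
\<close>

section \<open>Finiteness of the sets of solutions\<close>

lemma finite_unit_fraction_solutions:
  "finite {xs :: int list. length xs = k \<and> sorted_wrt (<) xs \<and> (\<forall>x\<in>set xs. 0 < x) \<and>
     (\<Sum>x\<leftarrow>xs. 1 / real_of_int x) = r}" (is "finite (?S k r)")
proof (induction k arbitrary: r)
  case 0
  have "?S 0 r \<subseteq> {[]}" by auto
  then show ?case by (rule finite_subset) simp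
next
  case (Suc k)
  \<comment> \<open>The first entry \<open>x\<close> is the smallest, so the sum \<open>r\<close> is
    at most \<open>Suc k / x\<close>; this leaves finitely many \<open>x\<close>. The tail solves
    the problem for \<open>r - 1 / x\<close>, hence the induction over arbitrary
    \<open>r\<close>.\<close>
  have "?S (Suc k) r \<subseteq> (\<Union>x\<in>{1..\<lfloor>real (Suc k) / r\<rfloor>}. (#) x ` ?S k (r - 1 / real_of_int x))"
  proof
    fix zs assume zs: "zs \<in> ?S (Suc k) r"
    then obtain x xs where eq: "zs = x # xs" by (cases zs) auto
    have x: "0 < x" and xs: "\<forall>y\<in>set xs. x < y" "length xs = k"
      and sum: "1 / real_of_int x + (\<Sum>y\<leftarrow>xs. 1 / real_of_int y) = r"
      using zs eq by auto
    have "(\<Sum>y\<leftarrow>xs. 1 / real_of_int y) \<le> (\<Sum>y\<leftarrow>xs. 1 / real_of_int x)"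
      using xs x by (intro sum_list_mono) (auto intro!: divide_left_mono)
    also have "\<dots> = real k / real_of_int x"
      using xs by (simp add: sum_list_triv)
    finally have up: "r \<le> real (Suc k) / real_of_int x"
      using sum by (simp add: add_divide_distrib)
    have "0 \<le> (\<Sum>y\<leftarrow>xs. 1 / real_of_int y)"
      using xs x by (intro sum_list_nonneg) auto
    then have "0 < r" using sum x by (smt (verit) divide_pos_pos of_int_0_less_iff)
    then have "real_of_int x \<le> real (Suc k) / r"
      using up x by (simp add: field_simps)
    then have "x \<in> {1..\<lfloor>real (Suc k) / r\<rfloor>}" using x by (simp add: le_floor_iff)
    moreover have "xs \<in> ?S k (r - 1 / real_of_int x)"
      using zs eq sum by auto
    ultimately show "zs \<in> (\<Union>x\<in>{1..\<lfloor>real (Suc k) / r\<rfloor>}. (#) x ` ?S k (r - 1 / real_of_int x))"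
      using eq by blast
  qed
  then show ?case by (rule finite_subset) (intro finite_UN_I finite_imageI Suc.IH, simp)
qed

lemma finite_odd_unit_fraction_solutions: "finite (odd_unit_fraction_solutions k)"
proof (rule finite_subset[OF _ finite_unit_fraction_solutions[of k 1]])
  have "(0::int) < x" if "1 < x" for x using that by linarith
  then show "odd_unit_fraction_solutions k \<subseteq> {xs. length xs = k \<and> sorted_wrt (<) xs \<and>
      (\<forall>x\<in>set xs. 0 < x) \<and> (\<Sum>x\<leftarrow>xs. 1 / real_of_int x) = 1}"
    unfolding odd_unit_fraction_solutions_def by blast
qed

section \<open>Divisor counts and coprime parts\<close>

definition pos_divisors :: "int \<Rightarrow> int set" where
  "pos_divisors y = {d. 0 < d \<and> d dvd y}"

lemma finite_pos_divisors: "0 < y \<Longrightarrow> finite (pos_divisors y)"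
  by (rule finite_subset[of _ "{1..y}"]) (auto simp: pos_divisors_def dest: zdvd_imp_le)

text \<open>No multiple of \<open>s\<close> divides \<open>y\<close>, so the divisors
  \<open>d\<close> of \<open>y\<close> and the products \<open>s * d\<close> form two disjoint,
  equally large families of divisors of \<open>y * s\<close>.\<close>

lemma card_pos_divisors_mult_coprime:
  assumes "0 < y" "1 < s" "coprime s y"
  shows "2 * card (pos_divisors y) \<le> card (pos_divisors (y * s))"
proof -
  let ?D = "pos_divisors y"
  have "?D \<inter> (*) s ` ?D = {}"
  proof -
    have False if "s * d dvd y" for d
    proof -
      have "s dvd y" using that by (rule dvd_mult_left)
      then have "is_unit s" using assms(3) by (meson coprime_common_divisor dvd_refl)
      then show False using assms(2) by simp
    qed
    then show ?thesis by (auto simp: pos_divisors_def)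
  qed
  moreover have "card ((*) s ` ?D) = card ?D"
    using assms(2) by (intro card_image inj_onI) simp
  ultimately have "2 * card ?D = card (?D \<union> (*) s ` ?D)"
    using finite_pos_divisors[OF assms(1)] by (simp add: card_Un_disjoint)
  also have "\<dots> \<le> card (pos_divisors (y * s))"
    using assms by (intro card_mono finite_pos_divisors) (auto simp: pos_divisors_def mult.commute[of y])
  finally show ?thesis .
qed

text \<open>For positive \<open>y\<close> this is \<open>y\<close> stripped of all primes dividing
  \<open>n\<close>.\<close>

definition coprime_part :: "int \<Rightarrow> int \<Rightarrow> int" where
  "coprime_part y n = Max {d \<in> pos_divisors y. coprime d n}"

lemma coprime_part:
  assumes "0 < y"
  shows "0 < coprime_part y n" "coprime_part y n dvd y" "coprime (coprime_part y n) n"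
    and "prime p \<Longrightarrow> p dvd y \<Longrightarrow> \<not> p dvd n \<Longrightarrow> p dvd coprime_part y n"
proof -
  let ?C = "{d \<in> pos_divisors y. coprime d n}"
  have fin: "finite ?C" using finite_pos_divisors[OF assms] by simp
  have "1 \<in> ?C" by (simp add: pos_divisors_def)
  then have "coprime_part y n \<in> ?C"
    unfolding coprime_part_def using fin by (intro Max_in) auto
  then show pos: "0 < coprime_part y n" and dvd: "coprime_part y n dvd y"
    and cop: "coprime (coprime_part y n) n"
    by (auto simp: pos_divisors_def)
  assume p: "prime p" "p dvd y" "\<not> p dvd n"
  show "p dvd coprime_part y n"
  \<comment> \<open>If \<open>p\<close> were missing, multiplying the maximum by \<open>p\<close>
    would give a larger divisor of \<open>y\<close> still coprime to \<open>n\<close>.\<close>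
  proof (rule ccontr)
    assume "\<not> p dvd coprime_part y n"
    then have "coprime p (coprime_part y n)" using p by (simp add: prime_imp_coprime)
    then have "p * coprime_part y n dvd y" using p dvd by (intro divides_mult)
    moreover have "coprime (p * coprime_part y n) n"
      using p cop by (simp add: prime_imp_coprime)
    moreover have "0 < p * coprime_part y n" using p pos prime_gt_0_int by simp
    ultimately have "p * coprime_part y n \<le> coprime_part y n"
      using Max_ge[OF fin, of "p * coprime_part y n"]
      by (simp add: coprime_part_def[symmetric]) (simp add: pos_divisors_def)
    then show False using prime_gt_1_int[OF p(1)] pos by simp
  qed
qed

text \<open>Each prime factor of \<open>y\<close> divides exactly one of the two terms \<open>n\<close> and
  \<open>c * coprime_part y n\<close>.\<close>

lemma coprime_add_coprime_part:
  assumes "0 < y" "coprime c y"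
  shows "coprime (n + c * coprime_part y n) y"
proof (rule ccontr)
  assume "\<not> ?thesis"
  then have "\<not> is_unit (gcd (n + c * coprime_part y n) y)" unfolding is_unit_gcd .
  moreover have "gcd (n + c * coprime_part y n) y \<noteq> 0" using assms(1) by simp
  ultimately obtain p where "prime p" "p dvd gcd (n + c * coprime_part y n) y"
    using prime_divisor_exists by blast
  then have p: "prime p" "p dvd n + c * coprime_part y n" "p dvd y" by simp_all
  show False
  proof (cases "p dvd n")
    case True
    then have "p dvd c * coprime_part y n" using p(2) by (simp add: dvd_add_right_iff)
    then have "p dvd c \<or> p dvd coprime_part y n" using p(1) by (simp add: prime_dvd_mult_iff)
    then show False
      using True p assms(2) coprime_part(3)[OF assms(1), of n]
      by (meson coprime_common_divisor not_prime_unit)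
  next
    case False
    then show False
      using p coprime_part(4)[OF assms(1) p(1,3) False] by (simp add: dvd_add_left_iff)
  qed
qed

section \<open>The two summands of a refinement\<close>

text \<open>The factors 3 and 27 make the 3-adic valuation tell \<open>a\<close> from \<open>b\<close>: hence \<open>a \<noteq> b\<close>, and
  the unordered pair \<open>{a, b}\<close> determines \<open>e\<close>.\<close>

definition summand_a :: "int \<Rightarrow> int" where
  "summand_a e = 3 * e"

definition summand_b :: "int \<Rightarrow> int \<Rightarrow> int" where
  "summand_b y e = 27 * coprime_part y (1 + summand_a e)"

definition summand_sum :: "int \<Rightarrow> int \<Rightarrow> int" where
  "summand_sum y e = 1 + summand_a e + summand_b y e"

text \<open>Both summands divide the odd number \<open>27 * y\<close>, so they are odd and their sum
  plus 1 is odd. Both are multiples of 3, so that sum is 1 modulo 3. Coprimality to \<open>y\<close>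
  is \<open>coprime_add_coprime_part\<close> with \<open>n = 1 + summand_a e\<close> and
  \<open>c = 27\<close>.\<close>

lemma summand_properties:
  assumes y: "0 < y" "odd y" "\<not> 3 dvd y" and e: "e \<in> pos_divisors y"
  shows "1 < summand_a e" "1 < summand_b y e"
    and "summand_a e dvd 27 * y" "summand_b y e dvd 27 * y"
    and "\<not> 9 dvd summand_a e" "9 dvd summand_b y e"
    and "odd (summand_sum y e)" "\<not> 3 dvd summand_sum y e" "coprime (summand_sum y e) y"
proof -
  note cp = coprime_part[OF y(1), of "1 + summand_a e"]
  have e': "0 < e" "e dvd y" using e by (auto simp: pos_divisors_def)
  show "1 < summand_a e" "1 < summand_b y e"
    using e' cp(1) by (auto simp: summand_a_def summand_b_def)
  have "3 * e dvd 27 * y" using mult_dvd_mono[of 3 27 e y] e' by simp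
  then show a: "summand_a e dvd 27 * y" by (simp add: summand_a_def)
  show b: "summand_b y e dvd 27 * y" using cp(2) by (simp add: summand_b_def)
  have "\<not> 3 dvd e" using e' y(3) dvd_trans by blast
  then show "\<not> 9 dvd summand_a e" by (simp add: summand_a_def) presburger
  show "9 dvd summand_b y e" by (simp add: summand_b_def)
  have "odd (27 * y)" using y by simp
  then have "odd (summand_a e)" "odd (summand_b y e)" using a b dvd_trans by blast+
  then show "odd (summand_sum y e)" by (simp add: summand_sum_def)
  show "\<not> 3 dvd summand_sum y e" by (simp add: summand_sum_def summand_a_def summand_b_def) presburger
  have "coprime (3::int) y" using y(3) by (intro prime_imp_coprime) auto
  then have "coprime (3 ^ 3 :: int) y" by (simp only: coprime_power_left_iff) simp
  then have "coprime (27::int) y" by simp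
  then show "coprime (summand_sum y e) y"
    using coprime_add_coprime_part[OF y(1), of 27 "1 + summand_a e"]
    by (simp add: summand_sum_def summand_b_def)
qed

section \<open>Refinement of solutions\<close>

text \<open>Dividing by the larger summand gives the smaller entry, so \<open>max\<close> before
  \<open>min\<close> keeps the list increasing.\<close>

definition refine :: "int list \<Rightarrow> int \<Rightarrow> int list" where
  "refine xs e = (let x = last xs; y = x div 27; a = summand_a e; b = summand_b y e; m = x * summand_sum y e
     in butlast xs @ [m div max a b, m div min a b, m])"

text \<open>The induction invariant: each divisor of \<open>y\<close> yields a refinement, so the
  last condition bounds the number of refinements from below.\<close>

definition rich_solutions :: "nat \<Rightarrow> int list set" where
  "rich_solutions k = {xs \<in> odd_unit_fraction_solutions (2 * k + 1).
     \<exists>y. last xs = 27 * y \<and> \<not> 3 dvd y \<and> 2 ^ (k - 1) \<le> card (pos_divisors y)}"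

lemma rich_solutionsE:
  assumes "xs \<in> rich_solutions k"
  obtains ys y where "xs = ys @ [27 * y]" "length ys = 2 * k" "0 < y" "odd y" "\<not> 3 dvd y"
    "2 ^ (k - 1) \<le> card (pos_divisors y)" "sorted_wrt (<) ys"
    "\<forall>z\<in>set ys. odd z \<and> 1 < z \<and> z < 27 * y"
    "(\<Sum>z\<leftarrow>ys. 1 / real_of_int z) + 1 / real_of_int (27 * y) = 1"
proof -
  obtain y where y: "last xs = 27 * y" "\<not> 3 dvd y" "2 ^ (k - 1) \<le> card (pos_divisors y)"
    using assms by (auto simp: rich_solutions_def)
  have sol: "length xs = 2 * k + 1" "sorted_wrt (<) xs" "\<forall>x\<in>set xs. odd x \<and> 1 < x"
      "(\<Sum>x\<leftarrow>xs. 1 / real_of_int x) = 1"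
    using assms by (auto simp: rich_solutions_def odd_unit_fraction_solutions_def)
  from sol(1) have "xs \<noteq> []" by auto
  then obtain ys where xs: "xs = ys @ [27 * y]" using y(1) by (metis append_butlast_last_id)
  show thesis
  proof (rule that[of ys y])
    show "0 < y" "odd y" using sol(3) by (simp_all add: xs)
    show "\<forall>z\<in>set ys. odd z \<and> 1 < z \<and> z < 27 * y" "sorted_wrt (<) ys"
      using sol(2,3) by (simp_all add: xs sorted_wrt_append)
    show "length ys = 2 * k" using sol(1) by (simp add: xs)
    show "(\<Sum>z\<leftarrow>ys. 1 / real_of_int z) + 1 / real_of_int (27 * y) = 1"
      using sol(4) by (simp add: xs)
  qed (use xs y in simp_all)
qed

lemma refine_rich:
  assumes xs: "xs \<in> rich_solutions k" and e: "e \<in> pos_divisors (last xs div 27)" and "1 \<le> k"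
  shows "refine xs e \<in> rich_solutions (Suc k)"
proof -
  obtain ys y where ys: "xs = ys @ [27 * y]" "length ys = 2 * k" "0 < y" "odd y" "\<not> 3 dvd y"
    "2 ^ (k - 1) \<le> card (pos_divisors y)" "sorted_wrt (<) ys"
    "\<forall>z\<in>set ys. odd z \<and> 1 < z \<and> z < 27 * y"
    "(\<Sum>z\<leftarrow>ys. 1 / real_of_int z) + 1 / real_of_int (27 * y) = 1"
    by (rule rich_solutionsE[OF xs])
  have e': "e \<in> pos_divisors y" using e ys(1) by simp
  \<comment> \<open>Here \<open>a\<close> is the larger summand and \<open>b\<close> the smaller
    one, whichever of the two formulas they come from.\<close>
  define a b s x where "a = max (summand_a e) (summand_b y e)" and "b = min (summand_a e) (summand_b y e)"
    and "s = summand_sum y e" and "x = 27 * y"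
  note sp = summand_properties[OF ys(3-5) e']
  have ab: "1 < b" "b < a" "a dvd x" "b dvd x"
    using sp by (auto simp: a_def b_def s_def x_def summand_sum_def max_def min_def le_less)
  have s_eq: "s = 1 + a + b" by (simp add: a_def b_def s_def summand_sum_def)
  have s: "odd s" "\<not> 3 dvd s" "coprime s y" using sp by (simp_all add: s_def)
  have "1 < s" using ab by (simp add: s_eq)
  have x: "0 < x" "odd x" using ys by (auto simp: x_def)
  obtain u v where uv: "x = a * u" "x = b * v" using ab by (metis dvdE)
  have pos: "0 < u" "0 < v" using uv x(1) ab zero_less_mult_pos[of a u] zero_less_mult_pos[of b v] by linarith+
  have odd: "odd u" "odd v" using uv x(2) by (metis even_mult_iff)+
  have ref: "refine xs e = ys @ [u * s, v * s, x * s]"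
  proof -
    have "x * s = a * (u * s)" "x * s = b * (v * s)" using uv by simp_all
    then have "x * s div a = u * s" "x * s div b = v * s"
      using ab by (metis nonzero_mult_div_cancel_left less_numeral_extra(4) less_trans not_one_less_zero)+
    then show ?thesis
      by (simp add: refine_def ys(1) Let_def a_def b_def s_def x_def)
  qed
  \<comment> \<open>From \<open>a < s\<close> follows \<open>x < u * s\<close>, which places the new
    entries above all old ones.\<close>
  have "u * a < u * s" using pos ab s_eq by (intro mult_strict_left_mono) auto
  then have "x < u * s" by (simp add: uv(1) mult.commute)
  moreover have "u < v"
  proof (rule ccontr)
    assume "\<not> u < v"
    then have "b * v < a * u" using ab pos by (intro mult_less_le_imp_less) auto
    then show False using uv by simp
  qed
  moreover have "v < x"
    using mult_strict_right_mono[of 1 b v] uv(2) ab pos by simp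
  ultimately have ord: "x < u * s" "u * s < v * s" "v * s < x * s"
    using \<open>1 < s\<close> by (auto intro: mult_strict_right_mono)
  have "1 / real_of_int (u * s) + 1 / real_of_int (v * s) + 1 / real_of_int (x * s) = 1 / real_of_int x"
  proof -
    have "1 / real_of_int (u * s) = a / (real_of_int x * s)"
      using ab unfolding uv(1) by simp
    moreover have "1 / real_of_int (v * s) = b / (real_of_int x * s)"
      using ab unfolding uv(2) by simp
    ultimately have "1 / real_of_int (u * s) + 1 / real_of_int (v * s) + 1 / real_of_int (x * s)
        = s / (real_of_int x * s)"
      by (simp add: s_eq add_divide_distrib)
    then show ?thesis using \<open>1 < s\<close> by simp
  qed
  then have sum: "(\<Sum>z\<leftarrow>refine xs e. 1 / real_of_int z) = 1"
    using ys(9) by (simp add: ref x_def)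
  have "\<forall>z\<in>set ys. odd z \<and> 1 < z \<and> z < x" using ys(8) by (simp add: x_def)
  then have "sorted_wrt (<) (refine xs e)" "\<forall>z\<in>set (refine xs e). odd z \<and> 1 < z"
    using ys(7) ord odd s(1) x by (fastforce simp: ref sorted_wrt_append)+
  then have "refine xs e \<in> odd_unit_fraction_solutions (2 * Suc k + 1)"
    using ys(2) sum by (simp add: odd_unit_fraction_solutions_def ref)
  moreover have "last (refine xs e) = 27 * (y * s)" by (simp add: ref x_def)
  moreover have "\<not> 3 dvd y * s"
    using ys(5) s(2) prime_dvd_mult_iff[of "3::int" y s] by simp
  moreover have "2 ^ (Suc k - 1) \<le> card (pos_divisors (y * s))"
  proof -
    \<comment> \<open>The subtraction is truncated, so the exponent really grows by one only for
      \<open>1 \<le> k\<close>.\<close>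
    have "(2::nat) ^ (Suc k - 1) = 2 * 2 ^ (k - 1)" using \<open>1 \<le> k\<close> by (cases k) auto
    also have "\<dots> \<le> 2 * card (pos_divisors y)" using ys(6) by simp
    also have "\<dots> \<le> card (pos_divisors (y * s))"
      using ys(3) s \<open>1 < s\<close> by (intro card_pos_divisors_mult_coprime)
    finally show ?thesis .
  qed
  ultimately show ?thesis unfolding rich_solutions_def by blast
qed

section \<open>Injectivity and counting\<close>

text \<open>All but the last three entries come from the old solution, whose last entry is forced by
  the total 1. The new last entry then gives \<open>a + b\<close>, and the third from the end gives
  \<open>max a b\<close>.\<close>

lemma inj_on_refine:
  "inj_on (\<lambda>(xs, e). refine xs e) (SIGMA xs:rich_solutions k. pos_divisors (last xs div 27))"
proof (intro inj_onI, clarsimp)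
  fix xs e xs' e'
  assume xs: "xs \<in> rich_solutions k" and e: "e \<in> pos_divisors (last xs div 27)"
    and xs': "xs' \<in> rich_solutions k" and e': "e' \<in> pos_divisors (last xs' div 27)"
    and eq: "refine xs e = refine xs' e'"
  obtain ys y where ys: "xs = ys @ [27 * y]" "0 < y" "odd y" "\<not> 3 dvd y"
    "(\<Sum>z\<leftarrow>ys. 1 / real_of_int z) + 1 / real_of_int (27 * y) = 1"
    by (rule rich_solutionsE[OF xs])
  obtain ys' y' where ys': "xs' = ys' @ [27 * y']"
    "(\<Sum>z\<leftarrow>ys'. 1 / real_of_int z) + 1 / real_of_int (27 * y') = 1"
    by (rule rich_solutionsE[OF xs'])
  have "ys = ys'" using eq by (simp add: refine_def ys(1) ys'(1) Let_def)
  have "1 / real_of_int (27 * y) = 1 / real_of_int (27 * y')"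
    using ys(5) ys'(2) unfolding \<open>ys = ys'\<close> by linarith
  then have y: "y' = y" by simp
  have ediv: "e \<in> pos_divisors y" "e' \<in> pos_divisors y"
    using e e' ys(1) ys'(1) y by simp_all
  note sp = summand_properties[OF ys(2-4) ediv(1)] and sp' = summand_properties[OF ys(2-4) ediv(2)]
  define a b a' b' m where "a = summand_a e" and "b = summand_b y e"
    and "a' = summand_a e'" and "b' = summand_b y e'" and "m = 27 * y * summand_sum y e"
  have "m = 27 * y * summand_sum y e'" "m div max a b = m div max a' b'"
    using eq ys(2) by (auto simp: refine_def ys(1) ys'(1) y Let_def a_def b_def a'_def b'_def m_def)
  then have sums: "summand_sum y e = summand_sum y e'" using ys(2) by (simp add: m_def)
  have "max a b dvd m" "max a' b' dvd m"
    using sp(3,4) sp'(3,4) by (auto simp: a_def b_def a'_def b'_def m_def max_def)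
  moreover have "0 < m" using sp(1,2) ys(2) by (simp add: m_def summand_sum_def)
  ultimately have "max a b = max a' b'"
    using \<open>m div max a b = m div max a' b'\<close>
    by (metis dvd_div_eq_0_iff dvd_mult_div_cancel less_irrefl mult_cancel_right)
  moreover have "a + b = a' + b'" using sums by (simp add: summand_sum_def a_def b_def a'_def b'_def)
  \<comment> \<open>9 divides \<open>b\<close> and \<open>b'\<close> but neither \<open>a\<close>
    nor \<open>a'\<close>, which excludes the swapped pair.\<close>
  moreover have "a \<noteq> b'" "b \<noteq> a'" using sp(5,6) sp'(5,6) by (auto simp: a_def b_def a'_def b'_def)
  ultimately have "a = a'" by (auto simp: max_def split: if_splits)
  then have "e = e'" by (simp add: a_def a'_def summand_a_def)
  then show "xs = xs' \<and> e = e'" using \<open>ys = ys'\<close> y ys(1) ys'(1) by simp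
qed

lemma rich_solutions_subset: "rich_solutions k \<subseteq> odd_unit_fraction_solutions (2 * k + 1)"
  unfolding rich_solutions_def by blast

lemma finite_rich_solutions: "finite (rich_solutions k)"
  using rich_solutions_subset finite_odd_unit_fraction_solutions by (rule finite_subset)

text \<open>The pairs of a solution and a divisor embed into the longer solutions by
  \<open>refine\<close>, and every solution occurs in at least \<open>2 ^ (k - 1)\<close>
  pairs.\<close>

lemma card_rich_solutions_Suc:
  assumes "1 \<le> k"
  shows "2 ^ (k - 1) * card (rich_solutions k) \<le> card (rich_solutions (Suc k))"
proof -
  let ?P = "SIGMA xs:rich_solutions k. pos_divisors (last xs div 27)"
  have pd: "0 < last xs div 27 \<and> 2 ^ (k - 1) \<le> card (pos_divisors (last xs div 27))"
    if xs: "xs \<in> rich_solutions k" for xs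
  proof -
    obtain ys y where "xs = ys @ [27 * y]" "0 < y" "2 ^ (k - 1) \<le> card (pos_divisors y)"
      by (rule rich_solutionsE[OF xs])
    then show ?thesis by simp
  qed
  have "2 ^ (k - 1) * card (rich_solutions k) = (\<Sum>xs\<in>rich_solutions k. 2 ^ (k - 1))" by simp
  also have "\<dots> \<le> (\<Sum>xs\<in>rich_solutions k. card (pos_divisors (last xs div 27)))"
    using pd by (intro sum_mono) blast
  also have "\<dots> = card ?P"
    using pd by (intro card_SigmaI[symmetric] finite_rich_solutions ballI finite_pos_divisors) blast
  also have "\<dots> \<le> card (rich_solutions (Suc k))"
    using refine_rich[OF _ _ assms]
    by (intro card_inj_on_le[OF inj_on_refine] finite_rich_solutions) auto
  finally show ?thesis .
qed

lemma card_rich_solutions_4: "1 \<le> card (rich_solutions 4)"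
proof -
  have "{1, 5, 7, 11, 35, 55, 77, 385} \<subseteq> pos_divisors 385"
    by (simp add: pos_divisors_def)
  then have "card {1, 5, 7, 11, 35, 55, 77, 385 :: int} \<le> card (pos_divisors 385)"
    by (intro card_mono finite_pos_divisors) simp_all
  then have "2 ^ (4 - 1) \<le> card (pos_divisors 385)" by simp
  \<comment> \<open>Over the denominator 10395 the numerators are 3465 + 2079 + 1485 + 1155 + 945 +
    693 + 495 + 77 + 1 = 10395.\<close>
  moreover have "[3, 5, 7, 9, 11, 15, 21, 135, 10395] \<in> odd_unit_fraction_solutions (2 * 4 + 1)"
    by (simp add: odd_unit_fraction_solutions_def)
  moreover have "last [3, 5, 7, 9, 11, 15, 21, 135, 10395] = 27 * (385 :: int)" "\<not> 3 dvd (385 :: int)"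
    by simp_all
  ultimately have "[3, 5, 7, 9, 11, 15, 21, 135, 10395] \<in> rich_solutions 4"
    unfolding rich_solutions_def by blast
  then have "0 < card (rich_solutions 4)"
    using finite_rich_solutions card_gt_0_iff by blast
  then show ?thesis by simp
qed

theorem theorem1:
  fixes k :: nat
  assumes "k \<ge> 4"
  shows "real (T_o (2 * k + 1)) \<ge> sqrt 2 ^ ((k + 1) * (k - 4))"
proof -
  have "sqrt 2 ^ ((k + 1) * (k - 4)) \<le> real (card (rich_solutions k))"
    using assms
  proof (induction k rule: dec_induct)
    case base
    then show ?case using card_rich_solutions_4 by simp
  next
    case (step k)
    obtain j where j: "k = j + 4" using step.hyps by (metis le_add_diff_inverse2)
    \<comment> \<open>The exponent vanishes at 4 and grows by \<open>2 * (k - 1)\<close> per step,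
      so the bound grows by exactly the factor \<open>2 ^ (k - 1)\<close> of
      \<open>card_rich_solutions_Suc\<close>. Writing \<open>k = j + 4\<close> removes the truncated
      subtractions.\<close>
    have exp: "(Suc k + 1) * (Suc k - 4) = 2 * (k - 1) + (k + 1) * (k - 4)"
      by (simp add: j algebra_simps)
    have "sqrt 2 ^ ((Suc k + 1) * (Suc k - 4)) = 2 ^ (k - 1) * sqrt 2 ^ ((k + 1) * (k - 4))"
      unfolding exp by (simp only: power_add power_mult real_sqrt_pow2)
    also have "\<dots> \<le> 2 ^ (k - 1) * real (card (rich_solutions k))"
      using step.IH by simp
    also have "\<dots> = real (2 ^ (k - 1) * card (rich_solutions k))" by simp
    also have "\<dots> \<le> real (card (rich_solutions (Suc k)))"
      using card_rich_solutions_Suc[of k] step.hyps by (simp only: of_nat_le_iff)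
    finally show ?case .
  qed
  also have "card (rich_solutions k) \<le> T_o (2 * k + 1)"
    unfolding T_o_def
    by (intro card_mono finite_odd_unit_fraction_solutions rich_solutions_subset)
  finally show ?thesis by simp
qed

end
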